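(* There is an isometric embedding $\square^\infty\to\mathbf{F}_2$ of the vertex set of the infinite dimensional unit cube with the $\ell^1$-metric into the free group on two generators with the biinvariant word metric coming from the standard generators.
   Context: The infinite unit cube is $\bigcup_n[0,1]^n$, where $[0,1]^n$ is included in $[0,1]^{n+1}$ as $[0,1]^n\times\{0\}$; its vertex set $\square^\infty$ is the set of finitely supported sequences with values in $\{0,1\}$, with the $\ell^1$-metric $d(v,w)=\sum_i|v_i-w_i|$. Let $a,b$ be the standard generators of $\mathbf{F}_2$, $S=\{a^{\pm1},b^{\pm1}\}$, and $\overline S$ the set of all conjugates of elements of $S$. The biinvariant word norm is $\|g\|=\min\{k\ge0 : g=s_1\cdots s_k,\ s_i\in\overline S\}$, and the biinvariant word metric is $\mathbf{d}(g,h)=\|gh^{-1}\|$. *)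

theory Defs
  imports Complex_Main "HOL-Algebra.Generated_Groups"
begin

section \<open>The vertex set of the infinite unit cube\<close>

definition cube_vertices :: "(nat \<Rightarrow> real) set" where
  "cube_vertices = {v. (\<forall>i. v i \<in> {0, 1}) \<and> finite {i. v i \<noteq> 0}}"

text \<open>On \<^term>\<open>cube_vertices\<close> the series has only finitely many non-zero terms.\<close>

definition l1_dist :: "(nat \<Rightarrow> real) \<Rightarrow> (nat \<Rightarrow> real) \<Rightarrow> real" where
  "l1_dist v w = (\<Sum>i. \<bar>v i - w i\<bar>)"


section \<open>Free groups\<close>

text \<open>
  The free group on the elements of a type is modelled by reduced words. A letter \<^term>\<open>(x, True)\<close>
  stands for the generator \<^term>\<open>x\<close> and \<^term>\<open>(x, False)\<close> for its inverse. The product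
  prepends the letters of the first word one by one to the second word, cancelling whenever an
  inverse pair arises.
\<close>

type_synonym 'x letter = "'x \<times> bool"

definition inv_letter :: "'x letter \<Rightarrow> 'x letter" where
  "inv_letter l = (fst l, \<not> snd l)"

definition reduced :: "'x letter list \<Rightarrow> bool" where
  "reduced = successively (\<lambda>k l. l \<noteq> inv_letter k)"

fun prepend :: "'x letter \<Rightarrow> 'x letter list \<Rightarrow> 'x letter list" where
  "prepend k [] = [k]"
| "prepend k (l # w) = (if l = inv_letter k then w else k # l # w)"

definition free_group :: "'x letter list monoid" where
  "free_group = \<lparr>carrier = {w. reduced w}, mult = (\<lambda>u v. foldr prepend u v), one = []\<rparr>"

lemma inv_letter_inv_letter [simp]: "inv_letter (inv_letter k) = k"
  by (simp add: inv_letter_def)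

lemma reduced_Nil [simp]: "reduced []"
  by (simp add: reduced_def)

lemma reduced_single [simp]: "reduced [k]"
  by (simp add: reduced_def)

lemma reduced_Cons: "reduced (k # w) \<longleftrightarrow> w = [] \<or> (reduced w \<and> hd w \<noteq> inv_letter k)"
  by (cases w) (auto simp: reduced_def)

lemma reduced_ConsD: "reduced (k # w) \<Longrightarrow> reduced w"
  by (auto simp: reduced_Cons)

lemma reduced_prepend: "reduced w \<Longrightarrow> reduced (prepend k w)"
  by (cases w) (auto simp: reduced_Cons)

lemma reduced_foldr_prepend: "reduced w \<Longrightarrow> reduced (foldr prepend u w)"
  by (induction u) (auto intro: reduced_prepend)

lemma prepend_prepend_inv: "reduced w \<Longrightarrow> prepend k (prepend (inv_letter k) w) = w"
  by (cases w rule: list.exhaust; cases "tl w") (auto simp: reduced_Cons)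

lemma prepend_inv_prepend: "reduced w \<Longrightarrow> prepend (inv_letter k) (prepend k w) = w"
  using prepend_prepend_inv[of w "inv_letter k"] by simp

lemma foldr_prepend_Nil: "reduced w \<Longrightarrow> foldr prepend w [] = w"
proof (induction w)
  case (Cons k w)
  then have "foldr prepend w [] = w" by (auto dest: reduced_ConsD)
  with Cons.prems show ?case by (cases w) (auto simp: reduced_Cons)
qed simp

lemma foldr_prepend_prepend:
  "reduced w \<Longrightarrow> foldr prepend (prepend k u) w = prepend k (foldr prepend u w)"
  by (cases u) (auto simp: prepend_prepend_inv reduced_foldr_prepend)

lemma foldr_prepend_assoc:
  "reduced w \<Longrightarrow> foldr prepend (foldr prepend u v) w = foldr prepend u (foldr prepend v w)"
  by (induction u) (auto simp: foldr_prepend_prepend)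

lemma foldr_prepend_inverse:
  "reduced w \<Longrightarrow> foldr prepend (rev (map inv_letter u)) (foldr prepend u w) = w"
  by (induction u) (auto simp: prepend_inv_prepend reduced_foldr_prepend)

lemma group_free_group: "group free_group"
proof (rule groupI)
  fix u :: "'x letter list" assume u: "u \<in> carrier free_group"
  define v where "v = foldr prepend (rev (map inv_letter u)) []"
  have "foldr prepend v u = []"
    using u foldr_prepend_inverse[of "[]" u] foldr_prepend_assoc[of u "rev (map inv_letter u)" "[]"]
    by (simp add: v_def free_group_def foldr_prepend_Nil)
  moreover have "reduced v" by (simp add: v_def reduced_foldr_prepend)
  ultimately show "\<exists>v\<in>carrier free_group. v \<otimes>\<^bsub>free_group\<^esub> u = \<one>\<^bsub>free_group\<^esub>"
    by (auto simp: free_group_def)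
qed (auto simp: free_group_def reduced_foldr_prepend foldr_prepend_assoc)

definition gen :: "'x \<Rightarrow> 'x letter list" where
  "gen x = [(x, True)]"

lemma gen_in_carrier: "gen x \<in> carrier free_group"
  by (simp add: gen_def free_group_def)

lemma inv_gen: "inv\<^bsub>free_group\<^esub> gen x = [(x, False)]"
  by (rule group.inv_equality[OF group_free_group])
    (auto simp: gen_def free_group_def inv_letter_def)

lemma free_group_induct [consumes 1, case_names one gen inv]:
  assumes "w \<in> carrier free_group" and "P \<one>\<^bsub>free_group\<^esub>"
    and "\<And>x w. w \<in> carrier free_group \<Longrightarrow> P w \<Longrightarrow> P (gen x \<otimes>\<^bsub>free_group\<^esub> w)"
    and "\<And>x w. w \<in> carrier free_group \<Longrightarrow> P w \<Longrightarrow> P (inv\<^bsub>free_group\<^esub> gen x \<otimes>\<^bsub>free_group\<^esub> w)"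
  shows "P w"
  using assms(1)
proof (induction w)
  case Nil
  then show ?case using assms(2) by (simp add: free_group_def)
next
  case (Cons k w)
  then have w: "w \<in> carrier free_group" "P w"
    by (auto simp: free_group_def dest: reduced_ConsD)
  obtain x e where k: "k = (x, e)" by (cases k)
  have pre: "prepend k w = k # w"
    using Cons.prems by (cases w) (auto simp: free_group_def reduced_Cons)
  show ?case
  proof (cases e)
    case True
    then show ?thesis using assms(3)[OF w, of x] pre k by (simp add: gen_def free_group_def)
  next
    case False
    then show ?thesis using assms(4)[OF w, of x] pre k unfolding inv_gen
      by (simp add: free_group_def)
  qed
qed

text \<open>The universal property, confirming that \<^const>\<open>free_group\<close> is free on the elements \<^term>\<open>gen x\<close>.\<close>

theorem free_group_universal:
  assumes "group G" and \<phi>: "\<And>x. \<phi> x \<in> carrier G"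
  shows "\<exists>h\<in>hom free_group G. (\<forall>x. h (gen x) = \<phi> x) \<and>
    (\<forall>h'\<in>hom free_group G. (\<forall>x. h' (gen x) = \<phi> x) \<longrightarrow> (\<forall>w\<in>carrier free_group. h' w = h w))"
proof -
  interpret G: group G by fact
  interpret F: group free_group by (rule group_free_group)
  define ev where "ev = (\<lambda>k. if snd k then \<phi> (fst k) else inv\<^bsub>G\<^esub> \<phi> (fst k))"
  define h where "h = (\<lambda>w. foldr (\<lambda>k r. ev k \<otimes>\<^bsub>G\<^esub> r) w \<one>\<^bsub>G\<^esub>)"
  have ev: "ev k \<in> carrier G" for k using \<phi> by (simp add: ev_def)
  have ev_inv: "ev (inv_letter k) = inv\<^bsub>G\<^esub> ev k" for k
    using \<phi> by (simp add: ev_def inv_letter_def)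
  have h_closed: "h w \<in> carrier G" for w by (induction w) (auto simp: h_def ev)
  have h_Cons: "h (k # w) = ev k \<otimes>\<^bsub>G\<^esub> h w" for k w by (simp add: h_def)
  have h_prepend: "h (prepend k w) = ev k \<otimes>\<^bsub>G\<^esub> h w" for k w
  proof (cases w)
    case (Cons l w')
    then show ?thesis
      by (cases "l = inv_letter k")
        (simp_all add: h_Cons ev ev_inv h_closed G.m_assoc[symmetric])
  qed (simp add: h_Cons)
  have "h (foldr prepend u v) = h u \<otimes>\<^bsub>G\<^esub> h v" for u v
  proof (induction u)
    case Nil
    have "h [] = \<one>\<^bsub>G\<^esub>" by (simp add: h_def)
    then show ?case by (simp add: h_closed)
  qed (simp add: h_prepend h_Cons G.m_assoc ev h_closed)
  then have hom: "h \<in> hom free_group G" by (auto simp: hom_def free_group_def h_closed)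
  have h_gen: "h (gen x) = \<phi> x" for x
    using \<phi> by (simp add: h_def gen_def ev_def)
  have "h' w = h w"
    if "h' \<in> hom free_group G" "\<forall>x. h' (gen x) = \<phi> x" "w \<in> carrier free_group" for h' w
  proof -
    interpret A: group_hom free_group G h by unfold_locales fact
    interpret B: group_hom free_group G h' by unfold_locales fact
    show ?thesis
      using that(3)
      by (induction w rule: free_group_induct)
        (simp_all add: gen_in_carrier h_gen that(2))
  qed
  with hom h_gen show ?thesis by blast
qed


section \<open>Biinvariant word norm and metric\<close>

definition conjugates :: "('a, 'm) monoid_scheme \<Rightarrow> 'a set \<Rightarrow> 'a set" where
  "conjugates G S = {g \<otimes>\<^bsub>G\<^esub> s \<otimes>\<^bsub>G\<^esub> inv\<^bsub>G\<^esub> g | g s. g \<in> carrier G \<and> s \<in> S}"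

text \<open>The set \<^term>\<open>S\<close> is meant to be closed under inverses.\<close>

definition biinv_norm :: "('a, 'm) monoid_scheme \<Rightarrow> 'a set \<Rightarrow> 'a \<Rightarrow> nat" where
  "biinv_norm G S g =
     (LEAST k. \<exists>ss. length ss = k \<and> set ss \<subseteq> conjugates G S \<and>
        g = foldr (\<lambda>s r. s \<otimes>\<^bsub>G\<^esub> r) ss \<one>\<^bsub>G\<^esub>)"

definition biinv_dist :: "('a, 'm) monoid_scheme \<Rightarrow> 'a set \<Rightarrow> 'a \<Rightarrow> 'a \<Rightarrow> real" where
  "biinv_dist G S g h = real (biinv_norm G S (g \<otimes>\<^bsub>G\<^esub> inv\<^bsub>G\<^esub> h))"


section \<open>The free group on two generators\<close>

datatype two = Gen_a | Gen_b

definition F2 :: "two letter list monoid" where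
  "F2 = free_group"

definition S2 :: "two letter list set" where
  "S2 = {gen Gen_a, inv\<^bsub>F2\<^esub> gen Gen_a, gen Gen_b, inv\<^bsub>F2\<^esub> gen Gen_b}"

text \<open>Every element of \<^const>\<open>F2\<close> is a product of conjugates of elements of \<^const>\<open>S2\<close>,
  so the minimum defining its norm is taken over a non-empty set.\<close>

lemma F2_product_of_conjugates:
  assumes "g \<in> carrier F2"
  shows "\<exists>ss. set ss \<subseteq> conjugates F2 S2 \<and> g = foldr (\<lambda>s r. s \<otimes>\<^bsub>F2\<^esub> r) ss \<one>\<^bsub>F2\<^esub>"
proof -
  interpret F: group F2 unfolding F2_def by (rule group_free_group)
  have carr: "s \<in> carrier F2" if "s \<in> S2" for s
  proof -
    have "gen x \<in> carrier F2" for x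
      by (simp add: F2_def gen_in_carrier)
    with that show ?thesis by (auto simp: S2_def)
  qed
  have sub: "s \<in> conjugates F2 S2" if "s \<in> S2" for s
  proof -
    have "s = \<one>\<^bsub>F2\<^esub> \<otimes>\<^bsub>F2\<^esub> s \<otimes>\<^bsub>F2\<^esub> inv\<^bsub>F2\<^esub> \<one>\<^bsub>F2\<^esub>"
      using carr[OF that] by simp
    with that F.one_closed show ?thesis unfolding conjugates_def by blast
  qed
  have S2: "gen x \<in> S2" "inv\<^bsub>F2\<^esub> gen x \<in> S2" for x
    by (cases x; simp add: S2_def)+
  show ?thesis
    using assms unfolding F2_def
  proof (induction g rule: free_group_induct)
    case one
    show ?case by (rule exI[of _ "[]"]) simp
  next
    case (gen x w)
    then obtain ss where "set ss \<subseteq> conjugates free_group S2"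
      "w = foldr (\<lambda>s r. s \<otimes>\<^bsub>free_group\<^esub> r) ss \<one>\<^bsub>free_group\<^esub>" by blast
    then show ?case using sub[OF S2(1)[of x]]
      by (intro exI[of _ "gen x # ss"]) (simp add: F2_def)
  next
    case (inv x w)
    then obtain ss where "set ss \<subseteq> conjugates free_group S2"
      "w = foldr (\<lambda>s r. s \<otimes>\<^bsub>free_group\<^esub> r) ss \<one>\<^bsub>free_group\<^esub>" by blast
    then show ?case using sub[OF S2(2)[of x]]
      by (intro exI[of _ "(inv\<^bsub>free_group\<^esub> gen x) # ss"]) (simp add: F2_def)
  qed
qed


section \<open>Isometric embeddings\<close>

text \<open>For metrics \<^term>\<open>d\<close> and \<^term>\<open>e\<close>, injectivity on \<^term>\<open>M\<close> follows.\<close>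

definition isometric_embedding ::
    "'a set \<Rightarrow> ('a \<Rightarrow> 'a \<Rightarrow> real) \<Rightarrow> 'b set \<Rightarrow> ('b \<Rightarrow> 'b \<Rightarrow> real) \<Rightarrow> ('a \<Rightarrow> 'b) \<Rightarrow> bool" where
  "isometric_embedding M d N e f \<longleftrightarrow>
     (\<forall>x\<in>M. f x \<in> N) \<and> (\<forall>x\<in>M. \<forall>y\<in>M. e (f x) (f y) = d x y)"

end

theory Submission
  imports Defs "HOL-Library.Multiset"
begin

text \<open>
  For \<open>k\<^sub>i = i(i + 1)\<close> let \<open>x\<^sub>i = b\<^bsup>k\<^sub>i\<^esup> a b\<^bsup>-k\<^sub>i\<^esup>\<close>.
  The embedding sends a vertex \<open>v\<close> of the cube to the ordered product of the \<open>x\<^sub>i\<close> with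
  \<open>v\<^sub>i = 1\<close>. Two vertices that differ in one coordinate go to elements \<open>p q\<close> and \<open>p x\<^sub>i q\<close>,
  whose quotient is a conjugate of \<open>x\<^sub>i\<^bsup>\<plusminus>1\<^esup>\<close> and hence of \<open>a\<^bsup>\<plusminus>1\<^esup>\<close>; so the map does not
  increase distances (\<open>vertex_quotient_product\<close>).

  For the converse, a product of \<open>m\<close> conjugates of generators can be written as a word
  whose letters, after deletion of \<open>m\<close> of them, are paired off by a noncrossing matching of inverse
  letters. This property survives free reduction (\<open>cancels_reduce\<close>), so it holds for the reduced
  word of the quotient of the images of \<open>v\<close> and \<open>w\<close>, with \<open>m\<close> its norm. Passing to this word is
  what makes the argument work: call the exponent sum of \<open>b\<close> before a letter \<open>a\<^bsup>\<plusminus>1\<^esup>\<close> its level;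
  in the reduced word all levels are among the \<open>k\<^sub>i\<close>, which need not be so in an arbitrary
  product of conjugates.

  Suppose that \<open>p\<close> letters \<open>a\<^bsup>\<plusminus>1\<^esup>\<close> and \<open>q\<close> letters \<open>b\<^bsup>\<plusminus>1\<^esup>\<close> are deleted. The letters between two
  matched letters \<open>a\<^bsup>\<plusminus>1\<^esup>\<close> are matched among themselves or deleted, so the levels of the two
  differ by at most \<open>q\<close>. Since \<open>k\<^sub>i - k\<^sub>j > i\<close> for \<open>j < i\<close>, a letter at level \<open>k\<^sub>i\<close> with
  \<open>i \<ge> q\<close> can be matched only with another one at the same level. The signed number of letters at
  level \<open>k\<^sub>i\<close> is \<open>v\<^sub>i - w\<^sub>i\<close>, so each coordinate \<open>i \<ge> q\<close> in which
  \<open>v\<close> and \<open>w\<close> differ costs one deleted \<open>a\<^bsup>\<plusminus>1\<^esup>\<close>. The coordinates \<open>i < q\<close> number only \<open>q\<close>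
  and are paid for by the deleted letters \<open>b\<^bsup>\<plusminus>1\<^esup>\<close>. Hence \<open>v\<close> and \<open>w\<close> differ in at most \<open>p + q\<close>
  coordinates (\<open>differing_le_cancels\<close>).
\<close>

section \<open>Noncrossing cancellation\<close>

text \<open>
  A word cancels with a multiset \<open>M\<close> of generators if it can be partitioned into a noncrossing
  matching of inverse pairs and deleted letters, the latter accounted for by \<open>M\<close>. Allowing an
  arbitrary \<open>M\<close> for the empty word makes the relation monotone in \<open>M\<close>; thus it keeps holding with the
  same \<open>M\<close> when two deleted letters disappear in a free reduction. Recording generators
  rather than a bare number separates deleted letters \<open>a\<^bsup>\<plusminus>1\<^esup>\<close> from deleted letters \<open>b\<^bsup>\<plusminus>1\<^esup>\<close>.
\<close>

inductive cancels :: "'x letter list \<Rightarrow> 'x multiset \<Rightarrow> bool" where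
  Nil: "cancels [] M"
| delete: "cancels v M \<Longrightarrow> cancels (x # v) (add_mset (fst x) M)"
| match: "cancels u M \<Longrightarrow> cancels v N \<Longrightarrow> cancels (x # u @ inv_letter x # v) (M + N)"

lemma fst_inv_letter [simp]: "fst (inv_letter x) = fst x"
  by (simp add: inv_letter_def)

lemma cancels_add: "cancels w M \<Longrightarrow> cancels w (N + M)"
proof (induction rule: cancels.induct)
  case (delete v M x)
  then show ?case using cancels.delete[of v "N + M" x] by simp
next
  case (match u M v M' x)
  then show ?case using cancels.match[of u "N + M" v M' x] by (simp add: add.assoc)
qed (rule cancels.Nil)

lemma cancels_append: "cancels u M \<Longrightarrow> cancels v N \<Longrightarrow> cancels (u @ v) (M + N)"
proof (induction rule: cancels.induct)
  case (Nil M)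
  then show ?case by (simp add: cancels_add)
next
  case (delete u M x)
  then show ?case using cancels.delete[of "u @ v" "M + N" x] by simp
next
  case (match u M u' M' x)
  then show ?case using cancels.match[of u M "u' @ v" "M' + N" x] by (simp add: add.assoc)
qed

lemma cancels_single: "cancels [x] {#fst x#}"
  using cancels.delete[OF cancels.Nil[of "{#}"], of x] by simp

lemma cancels_Cons_cases:
  assumes "cancels (x # w) M"
  obtains (deleted) M' where "M = add_mset (fst x) M'" "cancels w M'"
  | (matched) u v M1 M2 where "w = u @ inv_letter x # v" "M = M1 + M2" "cancels u M1" "cancels v M2"
  using assms by (cases rule: cancels.cases) auto

text \<open>
  The relation is symmetric under reversal although its rules peel words from the left. The
  case distinction on the last letter is therefore an induction over the whole derivation.
\<close>

lemma cancels_snoc_cases: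
  assumes "cancels (w @ [x]) M"
  obtains (deleted) M' where "M = add_mset (fst x) M'" "cancels w M'"
  | (matched) u v M1 M2 where "w = u @ inv_letter x # v" "M = M1 + M2" "cancels u M1" "cancels v M2"
proof -
  have "(\<exists>M'. M = add_mset (fst x) M' \<and> cancels w M') \<or>
    (\<exists>u v M1 M2. w = u @ inv_letter x # v \<and> M = M1 + M2 \<and> cancels u M1 \<and> cancels v M2)"
    (is "?P w M")
    using assms
  proof (induction "w @ [x]" M arbitrary: w rule: cancels.induct)
    case (delete v M y)
    show ?case
    proof (cases w)
      case Nil
      with delete show ?thesis by auto
    next
      case (Cons z w')
      with delete have z: "z = y" "v = w' @ [x]" by auto
      from delete(2)[OF z(2)] show ?thesis
      proof (elim disjE exE conjE)
        fix M' assume M': "M = add_mset (fst x) M'" "cancels w' M'"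
        from cancels.delete[OF M'(2), of y] show ?thesis
          using M' Cons z by (auto simp: add_mset_commute)
      next
        fix u v M1 M2
        assume *: "w' = u @ inv_letter x # v" "M = M1 + M2" "cancels u M1" "cancels v M2"
        from cancels.delete[OF *(3), of y] have "cancels (y # u) (add_mset (fst y) M1)" .
        moreover have "w = (y # u) @ inv_letter x # v" using * Cons z by simp
        moreover have "add_mset (fst y) M = add_mset (fst y) M1 + M2" using * by simp
        ultimately show ?thesis using *(4) by blast
      qed
    qed
  next
    case (match u M v N y)
    show ?case
    proof (cases v rule: rev_cases)
      case Nil
      with match have "w = [] @ inv_letter x # u" by auto
      moreover have "cancels [] N" by (rule cancels.Nil)
      ultimately show ?thesis using match(1) by (metis add.commute)
    next
      case (snoc v' z)
      with match have z: "z = x" "v = v' @ [x]" and w: "w = y # u @ inv_letter y # v'" by auto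
      from match(4)[OF z(2)] show ?thesis
      proof (elim disjE exE conjE)
        fix M' assume M': "N = add_mset (fst x) M'" "cancels v' M'"
        from cancels.match[OF match(1) M'(2), of y] show ?thesis
          using M' w by auto
      next
        fix u' v'' M1 M2
        assume *: "v' = u' @ inv_letter x # v''" "N = M1 + M2" "cancels u' M1" "cancels v'' M2"
        from cancels.match[OF match(1) *(3), of y]
        have "cancels (y # u @ inv_letter y # u') (M + M1)" .
        moreover have "w = (y # u @ inv_letter y # u') @ inv_letter x # v''" using * w by simp
        moreover have "M + N = (M + M1) + M2" using * by (simp add: add.assoc)
        ultimately show ?thesis using *(4) by blast
      qed
    qed
  qed auto
  with that show thesis by blast
qed

text \<open>
  If the removed letter was matched, its partner becomes a deleted letter.
\<close>

lemma cancels_ConsD: "cancels (x # w) M \<Longrightarrow> cancels w (add_mset (fst x) M)"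
proof (erule cancels_Cons_cases)
  fix M' assume "M = add_mset (fst x) M'" "cancels w M'"
  then show ?thesis using cancels_add[of w M' "{#fst x, fst x#}"] by simp
next
  fix u v M1 M2
  assume "w = u @ inv_letter x # v" "M = M1 + M2" "cancels u M1" "cancels v M2"
  then show ?thesis
    using cancels_append[of u M1 "inv_letter x # v" "add_mset (fst x) M2"]
      cancels.delete[of v M2 "inv_letter x"] by simp
qed

text \<open>
  The next three lemmas treat the free reductions of a pair in which one letter is matched
  with a letter outside the pair: \<open>cancels_remove_pair\<close> reduces to them. In each of them,
  the partners of the two removed letters become partners of each other, or a deleted letter of
  the removed pair passes its deletion on to the partner of the other.
\<close>

lemma cancels_rotate:
  assumes "cancels (x # w) M" "cancels v N"
  shows "cancels (w @ x # v) (M + N)"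
  using assms(1)
proof (cases rule: cancels_Cons_cases)
  case (deleted M')
  then show ?thesis
    using cancels_append[OF deleted(2) cancels.delete[OF assms(2)], of x] by simp
next
  case (matched u u' M1 M2)
  from cancels_append[OF matched(3) cancels.match[OF matched(4) assms(2), of "inv_letter x"]]
  show ?thesis using matched(1,2) by (simp add: add.assoc)
qed

lemma cancels_rotate':
  assumes "cancels (w @ [x]) M" "cancels v N"
  shows "cancels (x # w @ v) (M + N)"
  using assms(1)
proof (cases rule: cancels_snoc_cases)
  case (deleted M')
  then show ?thesis
    using cancels.delete[OF cancels_append[OF deleted(2) assms(2)], of x] by simp
next
  case (matched u u' M1 M2)
  from cancels.match[OF matched(3) cancels_append[OF matched(4) assms(2)], of x]
  show ?thesis using matched(1,2) by (simp add: add.assoc)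
qed

lemma cancels_rotate_right:
  assumes "cancels u M" "cancels (x # w) N"
  shows "cancels (x # u @ w) (M + N)"
  using assms(2)
proof (cases rule: cancels_Cons_cases)
  case (deleted M')
  then show ?thesis
    using cancels.delete[OF cancels_append[OF assms(1) deleted(2)], of x] by simp
next
  case (matched v v' M1 M2)
  from cancels.match[OF cancels_append[OF assms(1) matched(3)] matched(4), of x]
  show ?thesis using matched(1,2) by (simp add: add.assoc)
qed

text \<open>
  Induction along the matching of the first letter \<open>x\<close>. Either the pair lies inside one of the two
  blocks cut out by \<open>x\<close> and its partner, or it contains \<open>x\<close> or its partner.
\<close>

lemma cancels_remove_pair:
  assumes "cancels (p @ y # inv_letter y # s) M"
  shows "cancels (p @ s) M"
  using assms
proof (induction "p @ y # inv_letter y # s" M arbitrary: p s rule: cancels.induct)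
  case (delete v M x)
  show ?case
  proof (cases p)
    case Nil
    with delete have "x = y" "v = inv_letter y # s" by auto
    then show ?thesis using cancels_ConsD[of "inv_letter y" s M] delete Nil by simp
  next
    case (Cons z p')
    with delete have "z = x" "cancels (p' @ s) M" by auto
    then show ?thesis using Cons cancels.delete by simp
  qed
next
  case (match u M v N x)
  show ?case
  proof (cases p)
    case Nil
    with match have x: "x = y" and eq: "u @ inv_letter y # v = inv_letter y # s" by auto
    show ?thesis
    proof (cases u)
      case Nil
      with eq have "v = s" by simp
      then show ?thesis using \<open>p = []\<close> match(3) cancels_add by simp
    next
      case (Cons z u')
      with eq have "z = inv_letter y" "s = u' @ inv_letter y # v" by auto
      then show ?thesis using \<open>p = []\<close> Cons match(1,3)
        cancels_rotate[of "inv_letter y" u' M v N] x by simp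
    qed
  next
    case (Cons z p')
    with match(5) have z: "z = x" and eq: "u @ inv_letter x # v = p' @ y # inv_letter y # s" by auto
    \<comment> \<open>The pair can lie behind the partner of \<open>x\<close>, begin with it, end with it, or lie before it.\<close>
    from eq consider
        (right) r where "p' = u @ inv_letter x # r" "v = r @ y # inv_letter y # s"
      | (at) "p' = u" "inv_letter x # v = y # inv_letter y # s"
      | (before) "u = p' @ [y]" "inv_letter x # v = inv_letter y # s"
      | (left) r where "u = p' @ y # inv_letter y # r" "r @ inv_letter x # v = s"
      by (auto simp: append_eq_append_conv2 append_eq_Cons_conv Cons_eq_append_conv)
    then show ?thesis
    proof cases
      case (right r)
      with match(4)[of r s] have "cancels (r @ s) N" by simp
      from cancels.match[OF match(1) this, of x] show ?thesis using right Cons z by simp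
    next
      case at
      then have "v = x # s" by auto
      with match(3) cancels_rotate_right[OF match(1)] have "cancels (x # u @ s) (M + N)" by simp
      then show ?thesis using at Cons z by simp
    next
      case before
      then have "y = x" "v = s" by (auto dest: arg_cong[where f = inv_letter])
      with cancels_rotate'[of p' x M v N] match(1,3) before show ?thesis using Cons z by simp
    next
      case (left r)
      with match(2)[of p' r] have "cancels (p' @ r) M" by simp
      from cancels.match[OF this match(3), of x] show ?thesis using left Cons z by auto
    qed
  qed
qed auto

lemma cancels_reduce: "cancels (p @ u @ w) M \<Longrightarrow> cancels (p @ foldr prepend u w) M"
proof (induction u arbitrary: p)
  case (Cons x u)
  from Cons.IH[of "p @ [x]"] Cons.prems have *: "cancels (p @ x # foldr prepend u w) M" by simp
  show ?case
  proof (cases "foldr prepend u w")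
    case Nil
    then show ?thesis using * by simp
  next
    case (Cons y w')
    then show ?thesis using * cancels_remove_pair[of p x w' M] by auto
  qed
qed simp

definition inv_word :: "'x letter list \<Rightarrow> 'x letter list" where
  "inv_word w = rev (map inv_letter w)"

lemma cancels_conjugate: "cancels (c @ x # inv_word c) {#fst x#}"
proof (induction c)
  case Nil
  then show ?case by (simp add: inv_word_def cancels_single)
next
  case (Cons y c)
  from cancels.match[OF this cancels.Nil[of "{#}"], of y] show ?case by (simp add: inv_word_def)
qed

section \<open>Evaluating words\<close>

definition word_value :: "'x letter list \<Rightarrow> 'x letter list" where
  "word_value w = foldr prepend w []"

lemma word_value_closed [simp]: "word_value w \<in> carrier free_group"
  by (simp add: word_value_def free_group_def reduced_foldr_prepend)

lemma word_value_append:
  "word_value (u @ v) = word_value u \<otimes>\<^bsub>free_group\<^esub> word_value v"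
  using foldr_prepend_assoc[of "foldr prepend v []" u "[]"]
  by (simp add: word_value_def free_group_def foldr_prepend_assoc reduced_foldr_prepend)

lemma word_value_Nil: "word_value [] = \<one>\<^bsub>free_group\<^esub>"
  by (simp add: word_value_def free_group_def)

lemma word_value_reduced: "w \<in> carrier free_group \<Longrightarrow> word_value w = w"
  by (simp add: word_value_def free_group_def foldr_prepend_Nil)

lemma word_value_inv_word: "word_value (inv_word w) = inv\<^bsub>free_group\<^esub> word_value w"
proof -
  have "word_value (inv_word w @ w) = []"
    using foldr_prepend_inverse[of "[]" w] by (simp add: word_value_def inv_word_def)
  then show ?thesis
    by (intro group.inv_equality[OF group_free_group, symmetric])
      (simp_all add: word_value_append[symmetric], simp add: free_group_def)
qed

lemma cancels_word_value: "cancels w M \<Longrightarrow> cancels (word_value w) M"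
  using cancels_reduce[of "[]" w "[]"] by (simp add: word_value_def)

lemma S2_letter: "S2 = {[x] | x. True}"
proof -
  have "(\<exists>x e. P x e) \<longleftrightarrow> P Gen_a True \<or> P Gen_a False \<or> P Gen_b True \<or> P Gen_b False" for P
    by (metis (full_types) two.exhaust)
  then show ?thesis
    unfolding S2_def F2_def inv_gen unfolding gen_def by auto
qed

text \<open>
  Each factor \<open>c x c\<^bsup>-1\<^esup>\<close> cancels after deletion of its middle letter \<open>x\<close>. Concatenation adds up the
  deletions, and free reduction to the product does not increase them.
\<close>

lemma product_of_conjugates_cancels:
  assumes "set ss \<subseteq> conjugates F2 S2"
  shows "\<exists>M. size M = length ss \<and> foldr (\<lambda>s r. s \<otimes>\<^bsub>F2\<^esub> r) ss \<one>\<^bsub>F2\<^esub> \<in> carrier F2 \<and>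
    cancels (foldr (\<lambda>s r. s \<otimes>\<^bsub>F2\<^esub> r) ss \<one>\<^bsub>F2\<^esub>) M"
  using assms
proof (induction ss)
  case Nil
  have "cancels [] {#}" by (rule cancels.Nil)
  then show ?case by (auto simp: F2_def free_group_def)
next
  case (Cons s ss)
  define r where "r = foldr (\<lambda>s r. s \<otimes>\<^bsub>F2\<^esub> r) ss \<one>\<^bsub>F2\<^esub>"
  from Cons obtain M where M: "size M = length ss" "r \<in> carrier F2" "cancels r M"
    by (auto simp: r_def)
  from Cons.prems obtain c x where c: "c \<in> carrier F2" "s = c \<otimes>\<^bsub>F2\<^esub> [x] \<otimes>\<^bsub>F2\<^esub> inv\<^bsub>F2\<^esub> c"
    by (auto simp: conjugates_def S2_letter)
  have "word_value [x] = [x]" by (simp add: word_value_def)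
  then have "s = word_value (c @ x # inv_word c)"
    using c word_value_append[of "c @ [x]" "inv_word c"]
    by (simp add: F2_def word_value_append word_value_reduced word_value_inv_word)
  then have "s \<otimes>\<^bsub>F2\<^esub> r = word_value ((c @ x # inv_word c) @ r)"
    using M(2) by (simp only: F2_def word_value_append word_value_reduced)
  moreover have "cancels (word_value ((c @ x # inv_word c) @ r)) (add_mset (fst x) M)"
    using cancels_append[OF cancels_conjugate M(3)] cancels_word_value by fastforce
  ultimately show ?case using M(1)
    by (intro exI[of _ "add_mset (fst x) M"]) (simp add: r_def[symmetric], simp add: F2_def)
qed

section \<open>Heights and the Fox derivative\<close>

definition sign :: "'x letter \<Rightarrow> int" where
  "sign x = (if snd x then 1 else - 1)"

text \<open>
  Following the exponent sum of \<open>b\<close> along a word gives every letter a height, and the levels of a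
  word are the heights of its letters \<open>a\<^bsup>\<plusminus>1\<^esup>\<close>. The Fox derivative
  \<open>\<partial>w/\<partial>a\<close> maps, under \<open>a \<mapsto> 1\<close> and \<open>b \<mapsto> t\<close>, to a Laurent polynomial in \<open>t\<close>
  that counts, with sign, the letters \<open>a\<^bsup>\<plusminus>1\<^esup>\<close> at each height. The function \<open>fox\<close> applies to it
  the linear functional \<open>t\<^sup>h \<mapsto> \<phi> h\<close>. (For the map \<open>a \<mapsto> 1\<close>, the usual
  shift by \<open>a\<^bsup>-1\<^esup>\<close> in the derivative of an inverse letter is invisible.)
\<close>

definition rise :: "two letter \<Rightarrow> int" where
  "rise x = (if fst x = Gen_b then sign x else 0)"

fun height :: "two letter list \<Rightarrow> int" where
  "height [] = 0"
| "height (x # w) = rise x + height w"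

fun levels :: "int \<Rightarrow> two letter list \<Rightarrow> int set" where
  "levels h [] = {}"
| "levels h (x # w) = (if fst x = Gen_a then {h} else {}) \<union> levels (h + rise x) w"

fun fox :: "(int \<Rightarrow> int) \<Rightarrow> int \<Rightarrow> two letter list \<Rightarrow> int" where
  "fox \<phi> h [] = 0"
| "fox \<phi> h (x # w) = (if fst x = Gen_a then sign x * \<phi> h else 0) + fox \<phi> (h + rise x) w"

lemma sign_inv_letter [simp]: "sign (inv_letter x) = - sign x"
  by (simp add: sign_def inv_letter_def)

lemma rise_inv_letter [simp]: "rise (inv_letter x) = - rise x"
  by (simp add: rise_def)

lemma height_append [simp]: "height (u @ v) = height u + height v"
  by (induction u) auto

lemma levels_append [simp]: "levels h (u @ v) = levels h u \<union> levels (h + height u) v"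
  by (induction u arbitrary: h) (auto simp: add.assoc)

lemma fox_append [simp]: "fox \<phi> h (u @ v) = fox \<phi> h u + fox \<phi> (h + height u) v"
  by (induction u arbitrary: h) (auto simp: add.assoc)

lemma height_inv_word [simp]: "height (inv_word w) = - height w"
  by (induction w) (auto simp: inv_word_def)

lemma rise_a: "fst x = Gen_a \<Longrightarrow> rise x = 0"
  by (simp add: rise_def)

lemma levels_inv_word: "levels (h + height w) (inv_word w) = levels h w"
proof (induction w arbitrary: h)
  case (Cons x w)
  have eq: "inv_word (x # w) = inv_word w @ [inv_letter x]" by (simp add: inv_word_def)
  from Cons[of "h + rise x"] show ?case by (auto simp: eq add.assoc[symmetric] rise_a)
qed (simp add: inv_word_def)

lemma fox_inv_word: "fox \<phi> (h + height w) (inv_word w) = - fox \<phi> h w"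
proof (induction w arbitrary: h)
  case (Cons x w)
  have eq: "inv_word (x # w) = inv_word w @ [inv_letter x]" by (simp add: inv_word_def)
  from Cons[of "h + rise x"] show ?case by (simp add: eq add.assoc[symmetric] rise_a)
qed (simp add: inv_word_def)

lemma fox_word_value: "fox \<phi> h (word_value w) = fox \<phi> h w"
proof -
  have "fox \<phi> h (prepend x v) = fox \<phi> h (x # v)" for x v and h
    by (cases v) (auto simp: rise_a)
  then show ?thesis unfolding word_value_def by (induction w arbitrary: h) auto
qed

text \<open>
  Removing an inverse pair does not move the remaining letters, so no new level arises.
\<close>

lemma levels_word_value: "levels h (word_value w) \<subseteq> levels h w"
proof -
  have "levels h (prepend x v) \<subseteq> levels h (x # v)" for x v and h
    by (cases v) auto
  then show ?thesis unfolding word_value_def by (induction w arbitrary: h) fastforce+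
qed

text \<open>
  Matched letters do not contribute to the exponent sum of \<open>b\<close>.
\<close>

lemma height_le_deleted: "cancels w M \<Longrightarrow> \<bar>height w\<bar> \<le> int (count M Gen_b)"
proof (induction rule: cancels.induct)
  case (delete v M x)
  then show ?case by (auto simp: rise_def sign_def)
qed auto

text \<open>
  If \<open>\<phi>\<close> does not distinguish levels of \<open>w\<close> at distance at most \<open>q\<close>, then it takes the same
  value at two matched letters \<open>a\<^bsup>\<plusminus>1\<^esup>\<close>, because by \<open>height_le_deleted\<close> the word between them changes the
  height by at most the number of its deleted letters \<open>b\<^bsup>\<plusminus>1\<^esup>\<close>. The contributions of matched letters
  cancel, and each deleted letter contributes at most \<open>1\<close>.
\<close>

lemma fox_le_deleted:
  assumes "cancels w M" and "count M Gen_b \<le> q"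
    and bound: "\<And>i. \<bar>\<phi> i\<bar> \<le> 1"
    and const: "\<And>i j. i \<in> levels h w \<Longrightarrow> j \<in> levels h w \<Longrightarrow> \<bar>i - j\<bar> \<le> int q \<Longrightarrow> \<phi> i = \<phi> j"
  shows "\<bar>fox \<phi> h w\<bar> \<le> int (count M Gen_a)"
  using assms(1,2) const
proof (induction arbitrary: h rule: cancels.induct)
  case (delete v M x)
  have q: "count M Gen_b \<le> q" using delete.prems(1) by (auto split: if_splits)
  have "\<bar>fox \<phi> (h + rise x) v\<bar> \<le> int (count M Gen_a)"
    by (rule delete.IH[OF q], rule delete.prems(2)) auto
  moreover have "\<bar>sign x * \<phi> h\<bar> \<le> 1" using bound[of h] by (auto simp: sign_def)
  ultimately show ?case by auto
next
  case (match u M v N x)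
  let ?h = "h + rise x + height u"
  have q: "count M Gen_b \<le> q" "count N Gen_b \<le> q" using match.prems(1) by auto
  have u: "\<bar>fox \<phi> (h + rise x) u\<bar> \<le> int (count M Gen_a)"
    by (rule match.IH(1)[OF q(1)], rule match.prems(2)) auto
  have v: "\<bar>fox \<phi> (?h - rise x) v\<bar> \<le> int (count N Gen_a)"
    by (rule match.IH(2)[OF q(2)], rule match.prems(2)) auto
  have "\<phi> h = \<phi> ?h" if "fst x = Gen_a"
    using that height_le_deleted[OF match.hyps(1)] q(1) by (intro match.prems(2)) (auto simp: rise_a)
  then show ?case using u v by (auto simp: add.assoc algebra_simps)
qed simp

section \<open>The embedding\<close>

text \<open>
  These are the exponents \<open>k\<^sub>i\<close>. The quadratic growth is what \<open>level_gap\<close> needs: \<open>q\<close> deleted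
  letters \<open>b\<^bsup>\<plusminus>1\<^esup>\<close> must not suffice to bring level \<open>i \<ge> q\<close> down to a lower one.
\<close>

definition level :: "nat \<Rightarrow> nat" where
  "level i = i * (i + 1)"

lemma level_gap: "j < i \<Longrightarrow> level j + i < level i"
proof -
  assume "j < i"
  then obtain m where i: "i = Suc m" "j \<le> m" by (cases i) auto
  have "j * (j + 1) \<le> m * (m + 1)" using i by (intro mult_mono) auto
  then show ?thesis by (simp add: level_def i)
qed

lemma level_eq_iff: "level i = level j \<longleftrightarrow> i = j"
  using level_gap[of i j] level_gap[of j i] by (cases i j rule: linorder_cases) auto

definition climb :: "nat \<Rightarrow> two letter list" where
  "climb n = replicate n (Gen_b, True)"

definition edge_word :: "nat \<Rightarrow> two letter list" where
  "edge_word i = climb (level i) @ (Gen_a, True) # inv_word (climb (level i))"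

fun vertex_word :: "nat \<Rightarrow> nat set \<Rightarrow> two letter list" where
  "vertex_word 0 A = []"
| "vertex_word (Suc n) A = vertex_word n A @ (if n \<in> A then edge_word n else [])"

lemma height_climb [simp]: "height (climb n) = int n"
  by (induction n) (auto simp: climb_def rise_def sign_def)

lemma levels_climb [simp]: "levels h (climb n) = {}"
  by (induction n arbitrary: h) (auto simp: climb_def)

lemma fox_climb [simp]: "fox \<phi> h (climb n) = 0"
  by (induction n arbitrary: h) (auto simp: climb_def)

lemma height_edge_word [simp]: "height (edge_word i) = 0"
  by (simp add: edge_word_def rise_def)

lemma levels_edge_word: "levels h (edge_word i) = {h + int (level i)}"
  using levels_inv_word[of h "climb (level i)"] by (simp add: edge_word_def rise_def)

lemma fox_edge_word: "fox \<phi> h (edge_word i) = \<phi> (h + int (level i))"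
  using fox_inv_word[of \<phi> h "climb (level i)"] by (simp add: edge_word_def rise_def sign_def)

lemma height_vertex_word [simp]: "height (vertex_word n A) = 0"
  by (induction n) auto

lemma levels_vertex_word: "levels 0 (vertex_word n A) \<subseteq> range (\<lambda>i. int (level i))"
  by (induction n) (auto simp: levels_edge_word)

lemma fox_vertex_word:
  "fox \<phi> 0 (vertex_word n A) = (\<Sum>i<n. of_bool (i \<in> A) * \<phi> (int (level i)))"
  by (induction n) (auto simp: fox_edge_word)

definition vertex :: "nat \<Rightarrow> nat set \<Rightarrow> two letter list" where
  "vertex n A = word_value (vertex_word n A)"

lemma vertex_closed [simp]: "vertex n A \<in> carrier F2"
  by (simp add: vertex_def F2_def)

lemma vertex_stable:
  assumes "A \<subseteq> {..<n}" "n \<le> m"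
  shows "vertex m A = vertex n A"
proof -
  have "vertex_word (n + k) A = vertex_word n A" for k
    using assms(1) by (induction k) auto
  then show ?thesis using assms(2) by (metis le_Suc_ex vertex_def)
qed

lemma (in group) conjugates_conj:
  assumes "S \<subseteq> carrier G" "g \<in> carrier G" "s \<in> conjugates G S"
  shows "g \<otimes> s \<otimes> inv g \<in> conjugates G S"
proof -
  from assms(3) obtain c t where c: "c \<in> carrier G" "t \<in> S" "s = c \<otimes> t \<otimes> inv c"
    by (auto simp: conjugates_def)
  then have "g \<otimes> s \<otimes> inv g = (g \<otimes> c) \<otimes> t \<otimes> inv (g \<otimes> c)"
    using assms(1,2) by (simp add: subsetD m_assoc inv_mult_group)
  then show ?thesis using c assms(2) unfolding conjugates_def by blast
qed

lemma edge_conjugate: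
  "word_value (edge_word i) \<in> conjugates F2 S2"
  "inv\<^bsub>F2\<^esub> word_value (edge_word i) \<in> conjugates F2 S2"
proof -
  interpret F: group F2 unfolding F2_def by (rule group_free_group)
  let ?c = "word_value (climb (level i))"
  have c: "?c \<in> carrier F2" by (simp add: F2_def)
  have a: "gen Gen_a \<in> carrier F2" by (simp add: F2_def gen_in_carrier)
  have eq: "word_value (edge_word i) = ?c \<otimes>\<^bsub>F2\<^esub> gen Gen_a \<otimes>\<^bsub>F2\<^esub> inv\<^bsub>F2\<^esub> ?c"
    using word_value_append[of "climb (level i) @ [(Gen_a, True)]" "inv_word (climb (level i))"]
      word_value_reduced[OF gen_in_carrier, of Gen_a]
    by (simp add: edge_word_def F2_def word_value_append word_value_inv_word gen_def)
  have "inv\<^bsub>F2\<^esub> word_value (edge_word i) = ?c \<otimes>\<^bsub>F2\<^esub> inv\<^bsub>F2\<^esub> gen Gen_a \<otimes>\<^bsub>F2\<^esub> inv\<^bsub>F2\<^esub> ?c"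
    unfolding eq using c a by (simp add: F.inv_mult_group F.m_assoc)
  then show "inv\<^bsub>F2\<^esub> word_value (edge_word i) \<in> conjugates F2 S2"
    using c unfolding conjugates_def S2_def by blast
  show "word_value (edge_word i) \<in> conjugates F2 S2"
    using eq c unfolding conjugates_def S2_def by blast
qed

text \<open>
  Equal last factors cancel in the quotient. Otherwise a single factor \<open>x\<^sub>n\<^bsup>\<plusminus>1\<^esup>\<close> remains in the middle,
  and moving it to the front turns it into a conjugate.
\<close>

lemma vertex_quotient_product:
  "\<exists>ss. length ss = card {i. i < n \<and> (i \<in> A) \<noteq> (i \<in> B)} \<and> set ss \<subseteq> conjugates F2 S2 \<and>
     vertex n A \<otimes>\<^bsub>F2\<^esub> inv\<^bsub>F2\<^esub> vertex n B = foldr (\<lambda>s r. s \<otimes>\<^bsub>F2\<^esub> r) ss \<one>\<^bsub>F2\<^esub>"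
proof (induction n)
  interpret F: group F2 unfolding F2_def by (rule group_free_group)
  case 0
  have "vertex 0 C = \<one>\<^bsub>F2\<^esub>" for C
    by (simp add: vertex_def word_value_Nil F2_def)
  then show ?case by simp
next
  interpret F: group F2 unfolding F2_def by (rule group_free_group)
  case (Suc n)
  let ?x = "word_value (edge_word n)"
  let ?y = "\<lambda>C. if n \<in> C then ?x else \<one>\<^bsub>F2\<^esub>"
  let ?g = "vertex n A" and ?h = "vertex n B"
  let ?D = "\<lambda>n. {i. i < n \<and> (i \<in> A) \<noteq> (i \<in> B)}"
  have x: "?x \<in> carrier F2" by (simp add: F2_def)
  have step: "vertex (Suc n) C = vertex n C \<otimes>\<^bsub>F2\<^esub> ?y C" for C
    by (simp add: vertex_def word_value_append F2_def word_value_Nil)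
  have S2: "S2 \<subseteq> carrier F2"
    by (auto simp: S2_letter F2_def free_group_def)
  obtain ss where ss: "length ss = card (?D n)" "set ss \<subseteq> conjugates F2 S2"
    "?g \<otimes>\<^bsub>F2\<^esub> inv\<^bsub>F2\<^esub> ?h = foldr (\<lambda>s r. s \<otimes>\<^bsub>F2\<^esub> r) ss \<one>\<^bsub>F2\<^esub>"
    using Suc by blast
  show ?case
  proof (cases "n \<in> A \<longleftrightarrow> n \<in> B")
    case True
    then have "?D (Suc n) = ?D n" by (auto simp: less_Suc_eq)
    moreover have "vertex (Suc n) A \<otimes>\<^bsub>F2\<^esub> inv\<^bsub>F2\<^esub> vertex (Suc n) B = ?g \<otimes>\<^bsub>F2\<^esub> inv\<^bsub>F2\<^esub> ?h"
      using True x by (simp add: step F.inv_mult_group F.m_assoc F.inv_solve_left')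
        (simp add: F.m_assoc[symmetric])
    ultimately show ?thesis using ss by (intro exI[of _ ss]) simp
  next
    case False
    then have "?D (Suc n) = insert n (?D n)" by (auto simp: less_Suc_eq)
    then have card: "card (?D (Suc n)) = Suc (card (?D n))" by simp
    define z where "z = (if n \<in> A then ?x else inv\<^bsub>F2\<^esub> ?x)"
    have z: "z \<in> carrier F2" "z \<in> conjugates F2 S2"
      using x edge_conjugate[of n] by (auto simp: z_def)
    have "vertex (Suc n) A \<otimes>\<^bsub>F2\<^esub> inv\<^bsub>F2\<^esub> vertex (Suc n) B = ?g \<otimes>\<^bsub>F2\<^esub> z \<otimes>\<^bsub>F2\<^esub> inv\<^bsub>F2\<^esub> ?h"
      using False x by (auto simp: step z_def F.inv_mult_group F.m_assoc)
    also have "\<dots> = (?g \<otimes>\<^bsub>F2\<^esub> z \<otimes>\<^bsub>F2\<^esub> inv\<^bsub>F2\<^esub> ?g) \<otimes>\<^bsub>F2\<^esub> (?g \<otimes>\<^bsub>F2\<^esub> inv\<^bsub>F2\<^esub> ?h)"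
      using z(1) F.inv_solve_left' by (simp add: F.m_assoc) (simp add: F.m_assoc[symmetric])
    finally show ?thesis
      using ss card F.conjugates_conj[OF S2 _ z(2), of ?g]
      by (intro exI[of _ "(?g \<otimes>\<^bsub>F2\<^esub> z \<otimes>\<^bsub>F2\<^esub> inv\<^bsub>F2\<^esub> ?g) # ss"]) simp
  qed
qed

lemma size_two_multiset: "size M = count M Gen_a + count M Gen_b"
proof (induction M)
  case (add x M)
  then show ?case by (cases x) auto
qed simp

text \<open>
  The functional \<open>\<phi>\<close> is the sign pattern of the two vertices on the levels with index at least
  \<open>q\<close> and vanishes elsewhere. Its pairing with the Fox derivative counts the differing
  coordinates from \<open>q\<close> on, and by \<open>level_gap\<close> it does not separate levels that are within \<open>q\<close> of
  each other.
\<close>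

lemma differing_le_cancels:
  assumes "cancels (vertex n A \<otimes>\<^bsub>F2\<^esub> inv\<^bsub>F2\<^esub> vertex n B) M"
  shows "card {i. i < n \<and> (i \<in> A) \<noteq> (i \<in> B)} \<le> size M"
proof -
  define w where "w = vertex_word n A @ inv_word (vertex_word n B)"
  have value_w: "vertex n A \<otimes>\<^bsub>F2\<^esub> inv\<^bsub>F2\<^esub> vertex n B = word_value w"
    by (simp add: w_def vertex_def F2_def word_value_append word_value_inv_word)
  have lev: "levels 0 (word_value w) \<subseteq> range (\<lambda>i. int (level i))"
    using levels_word_value[of 0 w] levels_vertex_word[of n A] levels_vertex_word[of n B]
      levels_inv_word[of 0 "vertex_word n B"]
    by (auto simp: w_def)
  define q where "q = count M Gen_b"
  define s :: "nat \<Rightarrow> int" where "s i = of_bool (i \<in> A) - of_bool (i \<in> B)" for i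
  define \<phi> :: "int \<Rightarrow> int" where
    "\<phi> h = (if \<exists>i\<ge>q. h = int (level i) then s (THE i. h = int (level i)) else 0)" for h
  have \<phi>_level: "\<phi> (int (level i)) = (if q \<le> i then s i else 0)" for i
    by (auto simp: \<phi>_def level_eq_iff)
  have "fox \<phi> 0 (word_value w) = fox \<phi> 0 (vertex_word n A) - fox \<phi> 0 (vertex_word n B)"
    using fox_inv_word[of \<phi> 0 "vertex_word n B"] by (simp add: fox_word_value w_def)
  also have "\<dots> = (\<Sum>i<n. s i * \<phi> (int (level i)))"
    by (simp only: fox_vertex_word s_def left_diff_distrib sum_subtractf)
  also have "\<dots> = (\<Sum>i<n. of_bool (q \<le> i \<and> (i \<in> A) \<noteq> (i \<in> B)))"
    by (intro sum.cong) (auto simp: \<phi>_level s_def)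
  also have "\<dots> = int (card {i. i < n \<and> q \<le> i \<and> (i \<in> A) \<noteq> (i \<in> B)})"
    by (simp add: Int_def)
  finally have fox: "fox \<phi> 0 (word_value w) =
    int (card {i. i < n \<and> q \<le> i \<and> (i \<in> A) \<noteq> (i \<in> B)})" .
  have "\<bar>fox \<phi> 0 (word_value w)\<bar> \<le> int (count M Gen_a)"
  proof (rule fox_le_deleted)
    show "cancels (word_value w) M" using assms value_w by simp
    show "count M Gen_b \<le> q" by (simp add: q_def)
    show "\<bar>\<phi> h\<bar> \<le> 1" for h by (simp add: \<phi>_def s_def)
    fix h h' assume "h \<in> levels 0 (word_value w)" "h' \<in> levels 0 (word_value w)"
      and close: "\<bar>h - h'\<bar> \<le> int q"
    then obtain i j where ij: "h = int (level i)" "h' = int (level j)" using lev by blast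
    show "\<phi> h = \<phi> h'"
      using close level_gap[of i j] level_gap[of j i]
      by (cases i j rule: linorder_cases) (auto simp: ij \<phi>_level)
  qed
  with fox have far: "card {i. i < n \<and> q \<le> i \<and> (i \<in> A) \<noteq> (i \<in> B)} \<le> count M Gen_a" by simp
  have "card {i. i < n \<and> (i \<in> A) \<noteq> (i \<in> B)}
      \<le> card ({i. i < n \<and> q \<le> i \<and> (i \<in> A) \<noteq> (i \<in> B)} \<union> {..<q})"
    by (intro card_mono) auto
  also have "\<dots> \<le> card {i. i < n \<and> q \<le> i \<and> (i \<in> A) \<noteq> (i \<in> B)} + q"
    using card_Un_le[of _ "{..<q}"] by simp
  finally show ?thesis using far by (simp add: q_def size_two_multiset)
qed

lemma biinv_norm_vertex_quotient:
  "biinv_norm F2 S2 (vertex n A \<otimes>\<^bsub>F2\<^esub> inv\<^bsub>F2\<^esub> vertex n B)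
     = card {i. i < n \<and> (i \<in> A) \<noteq> (i \<in> B)}"
  unfolding biinv_norm_def
proof (rule Least_equality)
  show "\<exists>ss. length ss = card {i. i < n \<and> (i \<in> A) \<noteq> (i \<in> B)} \<and> set ss \<subseteq> conjugates F2 S2 \<and>
     vertex n A \<otimes>\<^bsub>F2\<^esub> inv\<^bsub>F2\<^esub> vertex n B = foldr (\<lambda>s r. s \<otimes>\<^bsub>F2\<^esub> r) ss \<one>\<^bsub>F2\<^esub>"
    by (rule vertex_quotient_product)
next
  fix k
  assume "\<exists>ss. length ss = k \<and> set ss \<subseteq> conjugates F2 S2 \<and>
     vertex n A \<otimes>\<^bsub>F2\<^esub> inv\<^bsub>F2\<^esub> vertex n B = foldr (\<lambda>s r. s \<otimes>\<^bsub>F2\<^esub> r) ss \<one>\<^bsub>F2\<^esub>"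
  then show "card {i. i < n \<and> (i \<in> A) \<noteq> (i \<in> B)} \<le> k"
    using product_of_conjugates_cancels differing_le_cancels by metis
qed

lemma l1_dist_cube:
  assumes "v \<in> cube_vertices" "w \<in> cube_vertices"
    and "{i. v i \<noteq> 0} \<subseteq> {..<n}" "{i. w i \<noteq> 0} \<subseteq> {..<n}"
  shows "l1_dist v w = real (card {i. i < n \<and> (v i \<noteq> 0) \<noteq> (w i \<noteq> 0)})"
proof -
  have val: "v i \<in> {0, 1}" "w i \<in> {0, 1}" for i
    using assms(1,2) by (auto simp: cube_vertices_def)
  have "l1_dist v w = (\<Sum>i<n. \<bar>v i - w i\<bar>)"
    unfolding l1_dist_def
  proof (intro suminf_finite)
    fix i assume "i \<notin> {..<n}"
    then have "v i = 0" "w i = 0" using assms(3,4) by blast+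
    then show "\<bar>v i - w i\<bar> = 0" by simp
  qed simp
  also have "\<dots> = (\<Sum>i<n. of_bool ((v i \<noteq> 0) \<noteq> (w i \<noteq> 0)))"
  proof (intro sum.cong refl)
    show "\<bar>v i - w i\<bar> = of_bool ((v i \<noteq> 0) \<noteq> (w i \<noteq> 0))" for i
      using val[of i] by auto
  qed
  also have "\<dots> = real (card {i. i < n \<and> (v i \<noteq> 0) \<noteq> (w i \<noteq> 0)})"
    by (simp add: Int_def)
  finally show ?thesis .
qed

theorem theorem3p6:
  shows "\<exists>f. isometric_embedding cube_vertices l1_dist (carrier F2) (biinv_dist F2 S2) f"
proof
  define supp :: "(nat \<Rightarrow> real) \<Rightarrow> nat set" where "supp v = {i. v i \<noteq> 0}" for v
  \<comment> \<open>Any bound on the support gives the same image, by \<open>vertex_stable\<close>; two vertices are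
    compared at a common one.\<close>
  define bd where "bd v = (SOME n. supp v \<subseteq> {..<n})" for v
  define f where "f v = vertex (bd v) (supp v)" for v
  have bd: "supp v \<subseteq> {..<bd v}" if "v \<in> cube_vertices" for v
    unfolding bd_def using that
    by (intro someI_ex[of "\<lambda>n. supp v \<subseteq> {..<n}"])
      (auto simp: cube_vertices_def supp_def finite_nat_set_iff_bounded)
  have "biinv_dist F2 S2 (f v) (f w) = l1_dist v w"
    if v: "v \<in> cube_vertices" and w: "w \<in> cube_vertices" for v w
  proof -
    define n where "n = max (bd v) (bd w)"
    have "f v = vertex n (supp v)" "f w = vertex n (supp w)"
      using vertex_stable[OF bd[OF v], of n] vertex_stable[OF bd[OF w], of n]
      by (simp_all add: f_def n_def)
    then have "biinv_dist F2 S2 (f v) (f w)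
        = real (card {i. i < n \<and> (i \<in> supp v) \<noteq> (i \<in> supp w)})"
      by (simp only: biinv_dist_def biinv_norm_vertex_quotient)
    moreover have "supp v \<subseteq> {..<n}" "supp w \<subseteq> {..<n}"
      using bd[OF v] bd[OF w] by (auto simp: n_def)
    ultimately show ?thesis using l1_dist_cube[OF v w, of n] by (simp add: supp_def)
  qed
  then show "isometric_embedding cube_vertices l1_dist (carrier F2) (biinv_dist F2 S2) f"
    by (simp add: isometric_embedding_def f_def)
qed

end
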